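(* Let $\alpha>0$ and let $x:[0,\infty)\to\mathbb R$ be a function of exponential order with Laplace transform $X(p)=\mathcal L\{x(t)\}(p)$. Then the Laplace transform of the dynamic-memory fractional integral of $x$ is $$\mathcal L\{\mathcal I_\Phi^\alpha x\}(p)=\Phi(p,\Theta)^{-\alpha}X(p)$$ (for those $p>0$ at which the Laplace transforms are defined).
   Context: $\mathcal L\{x(t)\}(p)=\int_0^\infty e^{-pt}x(t)\,dt$. A dynamic memory generator is a positive function $\Phi(p,\Theta)$ of the Laplace variable $p\in(0,\infty)$ and of fixed modulation parameters $\Theta$. For $\alpha>0$ the dynamic-memory kernel is $\Psi_\alpha(t;\Theta)=\mathcal L^{-1}\{\Phi(p,\Theta)^{-\alpha}\}(t)$, the locally integrable function on $(0,\infty)$ with $\mathcal L\{\Psi_\alpha(t;\Theta)\}(p)=\Phi(p,\Theta)^{-\alpha}$. The dynamic-memory fractional integral is $(\mathcal I_\Phi^\alpha x)(t)=\int_0^t\Psi_\alpha(t-s;\Theta)x(s)\,ds$. Standing assumption: functions are such that the integrals and Laplace transforms involved are well defined. *)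

theory Defs
  imports "HOL-Analysis.Analysis" "HOL-Library.Landau_Symbols"
begin

text \<open>
  Integrals over a half line are Lebesgue integrals, so a Laplace transform is defined at
  \<open>p\<close> when \<open>exp (- p * t) * f t\<close> is absolutely integrable. A function on \<open>[0, \<infinity>)\<close> or
  \<open>(0, \<infinity>)\<close> is represented by a function on the reals, whose other values play no role.
\<close>

definition laplace_defined_at :: "(real \<Rightarrow> real) \<Rightarrow> real \<Rightarrow> bool" where
  "laplace_defined_at f p \<longleftrightarrow> (\<lambda>t. exp (- p * t) * f t) absolutely_integrable_on {0..}"

definition laplace :: "(real \<Rightarrow> real) \<Rightarrow> real \<Rightarrow> real" where
  "laplace f p = (LINT t:{0..}|lebesgue. exp (- p * t) * f t)"

definition exponential_order :: "(real \<Rightarrow> real) \<Rightarrow> bool" where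
  "exponential_order f \<longleftrightarrow> (\<exists>c. f \<in> O[at_top](\<lambda>t. exp (c * t)))"

definition locally_integrable_on :: "(real \<Rightarrow> real) \<Rightarrow> real set \<Rightarrow> bool" where
  "locally_integrable_on f S \<longleftrightarrow> (\<forall>K. compact K \<and> K \<subseteq> S \<longrightarrow> f absolutely_integrable_on K)"

text \<open>
  The transform of an inverse Laplace transform of \<open>F\<close> need not converge on all of
  \<open>(0, \<infinity>)\<close>: \<open>exp t * sin t\<close> has the transform \<open>1 / ((p - 1)\<^sup>2 + 1)\<close> only for \<open>p > 1\<close>,
  although this expression is positive for every \<open>p > 0\<close>. We require that it converges at some
  \<open>p > 0\<close> (hence at every larger argument) and that it agrees with \<open>F\<close> wherever it converges.
  Such a function is unique only up to a null set, hence a relation instead of a function.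
\<close>

definition inverse_laplace :: "(real \<Rightarrow> real) \<Rightarrow> (real \<Rightarrow> real) \<Rightarrow> bool" where
  "inverse_laplace F f \<longleftrightarrow>
     locally_integrable_on f {0<..} \<and>
     (\<exists>p>0. laplace_defined_at f p) \<and>
     (\<forall>p>0. laplace_defined_at f p \<longrightarrow> laplace f p = F p)"

definition dm_generator :: "(real \<Rightarrow> 'a \<Rightarrow> real) \<Rightarrow> 'a \<Rightarrow> bool" where
  "dm_generator \<Phi> \<Theta> \<longleftrightarrow> (\<forall>p>0. \<Phi> p \<Theta> > 0)"

definition dm_kernel :: "(real \<Rightarrow> 'a \<Rightarrow> real) \<Rightarrow> 'a \<Rightarrow> real \<Rightarrow> (real \<Rightarrow> real) \<Rightarrow> bool" where
  "dm_kernel \<Phi> \<Theta> \<alpha> \<Psi> \<longleftrightarrow> inverse_laplace (\<lambda>p. \<Phi> p \<Theta> powr (- \<alpha>)) \<Psi>"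

text \<open>
  The dynamic-memory fractional integral depends on the generator, its parameters and the
  order only through the kernel \<open>\<Psi>\<close>.
\<close>

definition dm_integral :: "(real \<Rightarrow> real) \<Rightarrow> (real \<Rightarrow> real) \<Rightarrow> real \<Rightarrow> real" where
  "dm_integral \<Psi> x t = (LINT s:{0..t}|lebesgue. \<Psi> (t - s) * x s)"

end

theory Submission
  imports Defs
begin

text \<open>
  Put \<open>f t = exp (- p * t) * \<Psi> t\<close> and \<open>g t = exp (- p * t) * x t\<close> for \<open>t \<ge> 0\<close>, and
  \<open>f t = g t = 0\<close> for \<open>t < 0\<close>. That both transforms are defined at \<open>p\<close> says that \<open>f\<close> and
  \<open>g\<close> are Lebesgue integrable on the whole line. Since
  \<open>exp (- p * t) = exp (- p * (t - s)) * exp (- p * s)\<close>, and since \<open>f (t - s) * g s\<close> vanishes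
  unless \<open>0 \<le> s \<le> t\<close>, the function \<open>exp (- p * t) * dm_integral \<Psi> x t\<close>, cut off to \<open>t \<ge> 0\<close>,
  is the convolution of \<open>f\<close> and \<open>g\<close> at every \<open>t\<close>. The convolution of two integrable functions
  is integrable, and its integral is the product of their integrals; these are
  \<open>laplace \<Psi> p\<close>, which is \<open>\<Phi> p \<Theta> powr (- \<alpha>)\<close> because \<open>\<Psi>\<close> is a kernel, and \<open>laplace x p\<close>.

  The fact on convolutions is Fubini's theorem together with translation invariance. But for
  a Lebesgue measurable \<open>f\<close>, the function \<open>(t, s) \<mapsto> f (t - s)\<close> need not be measurable for the
  product of two copies of the \<sigma>-algebra of Lebesgue sets. Thus Fubini's theorem is applied to
  Borel functions that agree with \<open>f\<close> and \<open>g\<close> almost everywhere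
  (\<open>convolution_lborel\<close>). This replacement leaves the convolution unchanged at
  every point (\<open>convolution_lebesgue\<close>), because \<open>s \<mapsto> t - s\<close> preserves null sets.
\<close>

lemma convolution_lborel:
  fixes f g :: "real \<Rightarrow> real"
  assumes f: "integrable lborel f" and g: "integrable lborel g"
  shows "integrable lborel (\<lambda>t. LINT s|lborel. f (t - s) * g s)"
    and "(LINT t|lborel. LINT s|lborel. f (t - s) * g s) = (LINT t|lborel. f t) * (LINT t|lborel. g t)"
proof -
  have [measurable]: "f \<in> borel_measurable borel" "g \<in> borel_measurable borel"
    using f g by auto
  have shift_integrable: "integrable lborel (\<lambda>t. h (t - s))"
    if "integrable lborel h" for h :: "real \<Rightarrow> real" and s
    using lborel_integrable_real_affine[OF that, of 1 "- s"] by simp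
  have shift_integral: "(LINT t|lborel. h (t - s)) = (LINT t|lborel. h t)"
    for h :: "real \<Rightarrow> real" and s
    using lborel_integral_real_affine[of 1 h "- s"] by simp
  have norm_integral: "(LINT t|lborel. norm (f (t - s) * g s)) = (LINT t|lborel. \<bar>f t\<bar>) * \<bar>g s\<bar>" for s
    by (simp add: abs_mult shift_integral[where h = "\<lambda>t. \<bar>f t\<bar>"])
  \<comment> \<open>Fubini's criterion integrates over the second coordinate first. With \<open>s\<close> as the first
    coordinate, that inner integral is over \<open>t\<close>, where translation removes the shift by \<open>s\<close>.\<close>
  have "integrable (lborel \<Otimes>\<^sub>M lborel) (\<lambda>(s, t). f (t - s) * g s)"
  proof (rule lborel_pair.Fubini_integrable)
    show "integrable lborel (\<lambda>s. LINT t|lborel. norm (case (s, t) of (s, t) \<Rightarrow> f (t - s) * g s))"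
      unfolding prod.case norm_integral using g by simp
    show "AE s in lborel. integrable lborel (\<lambda>t. case (s, t) of (s, t) \<Rightarrow> f (t - s) * g s)"
      using shift_integrable[OF f] by simp
  qed measurable
  note product = this
  show "integrable lborel (\<lambda>t. LINT s|lborel. f (t - s) * g s)"
    by (rule lborel_pair.integrable_snd[OF product])
  have "(LINT t|lborel. LINT s|lborel. f (t - s) * g s)
      = (LINT s|lborel. LINT t|lborel. f (t - s) * g s)"
    by (rule lborel_pair.Fubini_integral[OF product])
  also have "\<dots> = (LINT s|lborel. (LINT t|lborel. f t) * g s)"
    by (simp add: shift_integral)
  finally show "(LINT t|lborel. LINT s|lborel. f (t - s) * g s)
      = (LINT t|lborel. f t) * (LINT t|lborel. g t)"
    by simp
qed

lemma integrable_lebesgue_borel_representative: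
  fixes f :: "'a::euclidean_space \<Rightarrow> real"
  assumes f: "integrable lebesgue f"
  obtains f' where "integrable lborel f'" "AE t in lborel. f t = f' t"
    "integral\<^sup>L lborel f' = integral\<^sup>L lebesgue f"
proof -
  obtain f' where f'[measurable]: "f' \<in> borel_measurable lborel"
    and ae: "AE t in lborel. f t = f' t"
    using completion_ex_borel_measurable_real[OF borel_measurable_integrable[OF f]] by auto
  have f'_lebesgue: "f' \<in> borel_measurable lebesgue"
    using measurable_completion[OF f'] .
  have "integrable lebesgue f'"
    using f f'_lebesgue AE_completion[OF ae] by (rule integrable_cong_AE_imp)
  moreover have "integral\<^sup>L lebesgue f' = integral\<^sup>L lebesgue f"
    using f'_lebesgue borel_measurable_integrable[OF f] AE_completion[OF ae]
    by (intro integral_cong_AE) auto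
  ultimately show thesis
    using that ae f' by (simp add: integrable_completion integral_completion)
qed

text \<open>
  The exceptional set need not be Borel, but it lies in a Borel null set, and the preimage of
  that set under \<open>s \<mapsto> t - s\<close> is null by invariance of the measure.
\<close>

lemma AE_lborel_reflect:
  fixes P :: "real \<Rightarrow> bool"
  assumes "AE s in lborel. P s"
  shows "AE s in lborel. P (t - s)"
proof -
  obtain N where N: "{s. \<not> P s} \<subseteq> N" "N \<in> null_sets lborel"
    using assms unfolding eventually_ae_filter by auto
  have "N \<in> sets borel"
    using N by auto
  moreover have "AE s in lborel. s \<notin> N"
    using N by (intro AE_not_in)
  ultimately have "AE s in lborel. t + (-1) * s \<notin> N"
    by (intro AE_borel_affine[where P = "\<lambda>s. s \<notin> N"]) auto
  then show ?thesis
    by eventually_elim (use N in auto)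
qed

text \<open>
  The Bochner integral of a function that is not integrable is 0. Hence the two
  convolutions below agree also at those \<open>t\<close> for which \<open>s \<mapsto> f (t - s) * g s\<close> is not integrable.
\<close>

lemma convolution_lebesgue:
  fixes f g :: "real \<Rightarrow> real"
  assumes f: "integrable lebesgue f" and g: "integrable lebesgue g"
  shows "integrable lebesgue (\<lambda>t. LINT s|lebesgue. f (t - s) * g s)"
    and "(LINT t|lebesgue. LINT s|lebesgue. f (t - s) * g s)
       = (LINT t|lebesgue. f t) * (LINT t|lebesgue. g t)"
proof -
  obtain f' where f': "integrable lborel f'" "AE t in lborel. f t = f' t"
      "integral\<^sup>L lborel f' = integral\<^sup>L lebesgue f"
    using integrable_lebesgue_borel_representative[OF f] by blast
  obtain g' where g': "integrable lborel g'" "AE t in lborel. g t = g' t"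
      "integral\<^sup>L lborel g' = integral\<^sup>L lebesgue g"
    using integrable_lebesgue_borel_representative[OF g] by blast
  have [measurable]: "f' \<in> borel_measurable borel" "g' \<in> borel_measurable borel"
    using f' g' by auto
  have pointwise: "(LINT s|lebesgue. f (t - s) * g s) = (LINT s|lborel. f' (t - s) * g' s)" for t
  proof -
    have ae: "AE s in lebesgue. f' (t - s) * g' s = f (t - s) * g s"
      using AE_completion[OF AE_lborel_reflect[OF f'(2), of t]] AE_completion[OF g'(2)]
      by eventually_elim simp
    have borel: "(\<lambda>s. f' (t - s) * g' s) \<in> borel_measurable lborel"
      by measurable
    then have "(\<lambda>s. f (t - s) * g s) \<in> borel_measurable lebesgue"
      using borel_measurable_AE[OF measurable_completion ae] by blast
    then have "(LINT s|lebesgue. f (t - s) * g s) = (LINT s|lebesgue. f' (t - s) * g' s)"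
      using measurable_completion[OF borel] ae by (intro integral_cong_AE) auto
    then show ?thesis
      using borel by (simp add: integral_completion)
  qed
  note conv = convolution_lborel[OF f'(1) g'(1)]
  have borel: "(\<lambda>t. LINT s|lborel. f' (t - s) * g' s) \<in> borel_measurable lborel"
    using conv(1) by (rule borel_measurable_integrable)
  show "integrable lebesgue (\<lambda>t. LINT s|lebesgue. f (t - s) * g s)"
    using conv(1) borel by (simp add: pointwise integrable_completion)
  show "(LINT t|lebesgue. LINT s|lebesgue. f (t - s) * g s)
      = (LINT t|lebesgue. f t) * (LINT t|lebesgue. g t)"
    using conv(2) borel f'(3) g'(3) by (simp add: pointwise integral_completion)
qed

text \<open>
  The exponential weight is multiplicative, so it can be moved under the integral; the
  indicators of the half line in the two factors leave exactly the interval from 0 to \<open>t\<close>,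
  and nothing for \<open>t < 0\<close>.
\<close>

lemma weighted_dm_integral_eq_convolution:
  "indicator {0..} t * (exp (- p * t) * dm_integral \<Psi> x t)
     = (LINT s|lebesgue. (indicator {0..} (t - s) * (exp (- p * (t - s)) * \<Psi> (t - s))) *
          (indicator {0..} s * (exp (- p * s) * x s)))"
proof -
  have "(indicator {0..} (t - s) * (exp (- p * (t - s)) * \<Psi> (t - s))) *
          (indicator {0..} s * (exp (- p * s) * x s))
      = indicator {0..} t * exp (- p * t) * (indicator {0..t} s * (\<Psi> (t - s) * x s))" for s
  proof -
    have "exp (- p * t) = exp (- p * (t - s)) * exp (- p * s)"
      by (simp add: algebra_simps flip: exp_add)
    then show ?thesis
      by (auto simp: indicator_def)
  qed
  then show ?thesis
    unfolding dm_integral_def set_lebesgue_integral_def by (simp only:) simp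
qed

lemma laplace_dm_integral:
  assumes "laplace_defined_at \<Psi> p" and "laplace_defined_at x p"
  shows "laplace_defined_at (dm_integral \<Psi> x) p"
    and "laplace (dm_integral \<Psi> x) p = laplace \<Psi> p * laplace x p"
proof -
  define weighted :: "(real \<Rightarrow> real) \<Rightarrow> real \<Rightarrow> real" where
    "weighted h t = indicator {0..} t * (exp (- p * t) * h t)" for h t
  have defined_iff: "laplace_defined_at h p \<longleftrightarrow> integrable lebesgue (weighted h)"
    and laplace_eq: "laplace h p = integral\<^sup>L lebesgue (weighted h)" for h
    by (simp_all add: laplace_defined_at_def laplace_def set_integrable_def
        set_lebesgue_integral_def weighted_def[abs_def])
  have conv: "weighted (dm_integral \<Psi> x) = (\<lambda>t. LINT s|lebesgue. weighted \<Psi> (t - s) * weighted x s)"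
    unfolding weighted_def by (rule ext) (rule weighted_dm_integral_eq_convolution)
  show "laplace_defined_at (dm_integral \<Psi> x) p"
    using assms convolution_lebesgue(1) unfolding defined_iff conv by blast
  show "laplace (dm_integral \<Psi> x) p = laplace \<Psi> p * laplace x p"
    using assms convolution_lebesgue(2) unfolding defined_iff laplace_eq conv by blast
qed

theorem theorem3p44:
  fixes \<Phi> :: "real \<Rightarrow> 'a \<Rightarrow> real" and \<Theta> :: 'a and \<alpha> :: real
    and \<Psi> x :: "real \<Rightarrow> real"
  assumes "dm_generator \<Phi> \<Theta>"
    and "\<alpha> > 0"
    and "dm_kernel \<Phi> \<Theta> \<alpha> \<Psi>"
    and "exponential_order x"
  shows "\<forall>p>0. laplace_defined_at \<Psi> p \<and> laplace_defined_at x p \<longrightarrow>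
           laplace_defined_at (dm_integral \<Psi> x) p \<and>
           laplace (dm_integral \<Psi> x) p = \<Phi> p \<Theta> powr (- \<alpha>) * laplace x p"
proof (intro allI impI)
  fix p :: real
  assume "p > 0" and defined: "laplace_defined_at \<Psi> p \<and> laplace_defined_at x p"
  then have "laplace \<Psi> p = \<Phi> p \<Theta> powr (- \<alpha>)"
    using assms(3) by (simp add: dm_kernel_def inverse_laplace_def)
  then show "laplace_defined_at (dm_integral \<Psi> x) p \<and>
      laplace (dm_integral \<Psi> x) p = \<Phi> p \<Theta> powr (- \<alpha>) * laplace x p"
    using defined laplace_dm_integral by simp
qed

end
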